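(* Let $n\geq 5$ and let $T$ be any tree on $n$ vertices. Then $$\eta_1(P_n)\leq \eta_1(T)\leq \eta_1(S_n),$$ where $P_n$ is the path and $S_n$ the star on $n$ vertices. Equality holds in the left inequality if and only if $T\cong P_n$, and equality holds in the right inequality if and only if $T\cong S_n$.
   Context: For a simple graph $G$ with vertex set $\{v_1,\dots,v_n\}$ and no isolated vertices, let $d_i$ denote the degree of $v_i$. The extended adjacency matrix $A_{ex}(G)=(a^{ex}_{ij})$ is the $n\times n$ matrix with $a^{ex}_{ij}=\frac12\left(\frac{d_i}{d_j}+\frac{d_j}{d_i}\right)$ if $v_iv_j$ is an edge of $G$ and $a^{ex}_{ij}=0$ otherwise. The extended spectral radius $\eta_1(G)$ is the largest eigenvalue of $A_{ex}(G)$. *)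

theory Defs
  imports
    "Graph_Theory.Graph_Theory"
    "Jordan_Normal_Form.Spectral_Radius"
begin

text \<open>
  A finite simple graph is a \<^const>\<open>pair_graph\<close>: an edge \<open>uv\<close> is the pair of arcs \<open>(u, v)\<close>, \<open>(v, u)\<close>,
  so \<^const>\<open>out_degree\<close> is the degree of a vertex.

  The constant \<^const>\<open>tree\<close> of \<^theory>\<open>Graph_Theory.Digraph_Component\<close> is unsuitable for such graphs, since it
  counts the closed walk \<open>u, v, u\<close> along a single edge as a cycle. A cycle of a simple graph is
  a \<^const>\<open>pre_digraph.cycle\<close> of length at least 3.
\<close>

definition simple_tree :: "'a pair_pre_digraph \<Rightarrow> bool" where
  "simple_tree G \<longleftrightarrow>
     pair_graph G \<and> connected (with_proj G) \<and>
     \<not> (\<exists>p. pre_digraph.cycle (with_proj G) p \<and> length p \<ge> 3)"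

abbreviation graph_iso :: "'a pair_pre_digraph \<Rightarrow> 'b pair_pre_digraph \<Rightarrow> bool" (infix "\<cong>\<^sub>g" 50) where
  "G \<cong>\<^sub>g H \<equiv> digraph_iso (with_proj G) (with_proj H)"

definition path_graph :: "nat \<Rightarrow> nat pair_pre_digraph" where
  "path_graph n = \<lparr> pverts = {..<n},
     parcs = {(i, j). i < n \<and> j < n \<and> (j = Suc i \<or> i = Suc j)} \<rparr>"

definition star_graph :: "nat \<Rightarrow> nat pair_pre_digraph" where
  "star_graph n = \<lparr> pverts = {..<n},
     parcs = {(i, j). i < n \<and> j < n \<and> i \<noteq> j \<and> (i = 0 \<or> j = 0)} \<rparr>"

abbreviation vdeg :: "'a pair_pre_digraph \<Rightarrow> 'a \<Rightarrow> nat" where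
  "vdeg G u \<equiv> out_degree (with_proj G) u"

definition vertex_numbering :: "'a pair_pre_digraph \<Rightarrow> (nat \<Rightarrow> 'a) \<Rightarrow> bool" where
  "vertex_numbering G v \<longleftrightarrow> bij_betw v {..<card (pverts G)} (pverts G)"

text \<open>
  The numbering \<open>v\<close> of the vertices is an explicit argument; the vertices are
  \<open>v 0, \<dots>, v (n - 1)\<close>.
\<close>

definition ext_adj_mat :: "'a pair_pre_digraph \<Rightarrow> (nat \<Rightarrow> 'a) \<Rightarrow> real mat" where
  "ext_adj_mat G v = mat (card (pverts G)) (card (pverts G)) (\<lambda>(i, j).
     if (v i, v j) \<in> parcs G
     then (real (vdeg G (v i)) / real (vdeg G (v j)) + real (vdeg G (v j)) / real (vdeg G (v i))) / 2
     else 0)"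

text \<open>
  \<^const>\<open>spectrum\<close> is the set of eigenvalues, here the real ones. This is no restriction, because
  \<^const>\<open>ext_adj_mat\<close> is symmetric.
\<close>

definition ext_spectral_radius :: "'a pair_pre_digraph \<Rightarrow> (nat \<Rightarrow> 'a) \<Rightarrow> real" ("\<eta>\<^sub>1") where
  "\<eta>\<^sub>1 G v = Max (spectrum (ext_adj_mat G v))"

end

theory Submission
  imports Defs "HOL-Analysis.Function_Topology"
begin

text \<open>
  Write \<open>h t = (t + 1 / t) / 2\<close>.

  Upper bound: as a tree has no cycles of length 3 or 4, at most \<open>n - 1\<close> walks of length two start
  at a given vertex. If all degrees are at most \<open>N\<close>, the weights are at most \<open>h N\<close>, so the row sums
  of the squared matrix are at most \<open>(h N)\<^sup>2 (n - 1)\<close> and every eigenvalue is at most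
  \<open>h N * sqrt (n - 1)\<close>. A tree that is not a star has \<open>N \<le> n - 2\<close>, whereas the star has the
  eigenvalue \<open>h (n - 1) * sqrt (n - 1)\<close>.

  Lower bound: the number 2 separates the path from all other trees. The path admits a positive
  strict supersolution \<open>A q < 2 q\<close>, so its eigenvalues are below 2. Any other tree has a vertex of
  degree at least 3, around which a nonnegative subsolution \<open>A x \<ge> 2 x\<close> (where \<open>x > 0\<close>) is
  supported, so its largest Rayleigh quotient is at least 2.
\<close>

section \<open>The Rayleigh quotient\<close>

text \<open>For small \<open>t\<close> of the sign of \<open>a\<close> the linear term dominates;
  \<open>t = a / (\<bar>b\<bar> + 1)\<close> is small enough. This is the first-order condition at a
  maximum.\<close>

lemma linear_coeff_zero_if_quadratic_nonpos:
  fixes a b :: real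
  assumes "\<And>t. a * t + b * t\<^sup>2 \<le> 0"
  shows "a = 0"
proof (rule ccontr)
  assume "a \<noteq> 0"
  define t where "t = a / (\<bar>b\<bar> + 1)"
  define d where "d = \<bar>b\<bar> + 1"
  have d: "d > 0" "t = a / d" by (auto simp: d_def t_def)
  have "a * t + b * t\<^sup>2 = a\<^sup>2 * (d + b) / d\<^sup>2"
    unfolding d(2) using d(1) by (simp add: power2_eq_square field_simps)
  moreover have "\<dots> > 0"
    using \<open>a \<noteq> 0\<close> d by (intro divide_pos_pos mult_pos_pos) (auto simp: d_def)
  ultimately show False
    using assms[of t] by linarith
qed

text \<open>The quadratic form attains a maximum on the unit sphere; the maximum is at least the
  quotient of \<open>x\<close>, and the maximiser is an eigenvector by the first variation.\<close>

lemma symmetric_eigenvalue_ge_Rayleigh_quotient: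
  fixes W :: "'a \<Rightarrow> 'a \<Rightarrow> real"
  assumes fin: "finite V"
    and sym: "\<And>u v. u \<in> V \<Longrightarrow> v \<in> V \<Longrightarrow> W u v = W v u"
    and x: "a \<in> V" "x a \<noteq> 0"
    and ge: "c * (\<Sum>u\<in>V. (x u)\<^sup>2) \<le> (\<Sum>u\<in>V. x u * (\<Sum>v\<in>V. W u v * x v))"
  shows "\<exists>k y. c \<le> k \<and> (\<exists>u\<in>V. y u \<noteq> 0) \<and> (\<forall>u\<in>V. (\<Sum>v\<in>V. W u v * y v) = k * y u)"
proof -
  define Q where "Q x = (\<Sum>u\<in>V. x u * (\<Sum>v\<in>V. W u v * x v))" for x
  define N where "N x = (\<Sum>u\<in>V. (x u)\<^sup>2)" for x :: "'a \<Rightarrow> real"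
  \<comment> \<open>\<open>Q\<close> and \<open>N\<close> read only the coordinates in
    \<open>V\<close>. Confining all coordinates, also those outside \<open>V\<close>, to a bounded
    interval gives a cube that is compact by Tychonoff's theorem, even for an infinite type.\<close>
  define B where "B = {x :: 'a \<Rightarrow> real. \<forall>i. x i \<in> {-1..1}}"
  have "compact B"
  proof -
    have "B = PiE UNIV (\<lambda>i. {-1..1})" by (auto simp: B_def PiE_def Pi_def)
    moreover have "compactin (product_topology (\<lambda>i. euclidean) UNIV) (PiE UNIV (\<lambda>i::'a. {-1..1::real}))"
      by (subst compactin_PiE) auto
    ultimately show ?thesis by (simp add: euclidean_product_topology)
  qed
  have coord: "continuous_on A (\<lambda>x::'a \<Rightarrow> real. x i)" for A i
    by (rule continuous_on_subset[OF continuous_on_product_coordinates]) auto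
  have contN: "continuous_on A N" for A
    unfolding N_def by (intro continuous_intros coord)
  have contQ: "continuous_on A Q" for A
    unfolding Q_def by (intro continuous_intros coord)
  define S where "S = B \<inter> {x. N x = 1}"
  have "closed {x. N x = 1}"
    using contN[of UNIV] by (intro closed_Collect_eq) auto
  then have "compact S"
    unfolding S_def by (intro compact_Int_closed \<open>compact B\<close>)
  have normalise: "\<exists>z\<in>S. \<exists>s>0. Q z = Q y / s \<and> N y = s" if y: "N y \<noteq> 0" for y
  proof -
    define s where "s = N y"
    have "N y \<ge> 0" by (auto simp: N_def intro: sum_nonneg)
    then have s: "s > 0" using y s_def by auto
    define z where "z u = (if u \<in> V then y u / sqrt s else 0)" for u
    have Nz: "N z = 1"
    proof -
      have "N z = (\<Sum>u\<in>V. (y u)\<^sup>2 / s)"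
        unfolding N_def by (intro sum.cong) (use s in \<open>auto simp: z_def power_divide\<close>)
      also have "\<dots> = 1" using s by (simp add: N_def s_def flip: sum_divide_distrib)
      finally show ?thesis .
    qed
    have "Q z = (\<Sum>u\<in>V. y u * (\<Sum>v\<in>V. W u v * y v) / s)"
    proof -
      have "z u * (\<Sum>v\<in>V. W u v * z v) = y u * (\<Sum>v\<in>V. W u v * y v) / s" if "u \<in> V" for u
      proof -
        have "(\<Sum>v\<in>V. W u v * z v) = (\<Sum>v\<in>V. W u v * y v) / sqrt s"
          unfolding sum_divide_distrib by (intro sum.cong) (auto simp: z_def)
        then show ?thesis using s that by (simp add: z_def)
      qed
      then show ?thesis by (simp add: Q_def)
    qed
    then have "Q z = Q y / s" by (simp add: Q_def sum_divide_distrib)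
    moreover have "z \<in> S"
    proof -
      have "z i \<in> {-1..1}" for i
      proof (cases "i \<in> V")
        case True
        then have "(z i)\<^sup>2 \<le> N z"
          unfolding N_def by (intro member_le_sum) (use fin in auto)
        then show ?thesis using Nz by (simp add: abs_square_le_1 abs_le_iff)
      qed (auto simp: z_def)
      then show ?thesis using Nz by (auto simp: S_def B_def)
    qed
    ultimately show ?thesis using s s_def by auto
  qed
  have "N x \<noteq> 0"
    using x fin by (auto simp: N_def sum_nonneg_eq_0_iff)
  then obtain x' s where x': "x' \<in> S" "s > 0" "Q x' = Q x / s" "N x = s"
    using normalise by blast
  then have "S \<noteq> {}" by auto
  then obtain y where y: "y \<in> S" "\<And>z. z \<in> S \<Longrightarrow> Q z \<le> Q y"
    using continuous_attains_sup[OF \<open>compact S\<close> _ contQ] by blast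
  define k where "k = Q y"
  have Ny: "N y = 1" using y by (simp add: S_def)
  \<comment> \<open>\<open>Q\<close> and \<open>N\<close> are both homogeneous of degree 2, so the
    maximum on the sphere bounds \<open>Q\<close> everywhere.\<close>
  have le: "Q z \<le> k * N z" for z
  proof (cases "N z = 0")
    case True
    then have "\<forall>u\<in>V. z u = 0" using fin by (auto simp: N_def sum_nonneg_eq_0_iff)
    then show ?thesis using True by (simp add: Q_def)
  next
    case False
    then obtain z' s where "z' \<in> S" "s > 0" "Q z' = Q z / s" "N z = s"
      using normalise by blast
    then show ?thesis using mult_left_mono[OF y(2)[of z'], of s] by (simp add: k_def field_simps)
  qed
  have "c \<le> k"
  proof -
    have "c * s \<le> Q x" using ge x'(4) by (simp add: Q_def N_def)
    then have "c \<le> Q x'" using x'(2,3) by (simp add: pos_le_divide_eq)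
    then show ?thesis using y(2)[OF x'(1)] by (simp add: k_def)
  qed
  moreover have "\<exists>u\<in>V. y u \<noteq> 0"
    using Ny by (auto simp: N_def intro: ccontr)
  moreover have "(\<Sum>v\<in>V. W u v * y v) = k * y u" if u: "u \<in> V" for u
  proof -
    \<comment> \<open>First variation of \<open>Q - k N \<le> 0\<close> at its maximiser \<open>y\<close>, in the direction of coordinate \<open>u\<close>.\<close>
    define d where "d w = (if w = u then 1 else 0 :: real)" for w
    define r where "r = (\<Sum>v\<in>V. W u v * y v)"
    have Wd: "(\<Sum>v\<in>V. W w v * d v) = W w u" for w
      using u fin by (simp add: d_def if_distrib cong: if_cong)
    have eq: "Q (\<lambda>w. y w + t * d w) = k + 2 * t * r + t\<^sup>2 * W u u" for t
    proof -
      have "Q (\<lambda>w. y w + t * d w) =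
          (\<Sum>w\<in>V. (y w + t * d w) * ((\<Sum>v\<in>V. W w v * y v) + t * (\<Sum>v\<in>V. W w v * d v)))"
        by (simp add: Q_def algebra_simps sum.distrib sum_distrib_left)
      also have "\<dots> = (\<Sum>w\<in>V. y w * (\<Sum>v\<in>V. W w v * y v)) + t * (\<Sum>w\<in>V. y w * W w u)
          + t * (\<Sum>w\<in>V. d w * (\<Sum>v\<in>V. W w v * y v)) + t\<^sup>2 * (\<Sum>w\<in>V. d w * W w u)"
        unfolding Wd
        by (simp add: algebra_simps sum.distrib sum_distrib_left power2_eq_square)
      \<comment> \<open>Symmetry of \<open>W\<close> makes the two cross terms equal, which yields
        the coefficient \<open>2 * r\<close> of \<open>t\<close>.\<close>
      also have "(\<Sum>w\<in>V. y w * W w u) = r"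
        unfolding r_def by (intro sum.cong) (use sym u in auto)
      also have "(\<Sum>w\<in>V. d w * (\<Sum>v\<in>V. W w v * y v)) = r"
        using u fin by (simp add: d_def r_def if_distrib if_distribR cong: if_cong)
      also have "(\<Sum>w\<in>V. d w * W w u) = W u u"
        using u fin by (simp add: d_def if_distrib if_distribR cong: if_cong)
      finally show ?thesis by (simp add: k_def Q_def)
    qed
    have eqN: "N (\<lambda>w. y w + t * d w) = 1 + 2 * t * y u + t\<^sup>2" for t
    proof -
      have "N (\<lambda>w. y w + t * d w) = N y + 2 * t * (\<Sum>w\<in>V. y w * d w) + t\<^sup>2 * (\<Sum>w\<in>V. d w * d w)"
        by (simp add: N_def algebra_simps sum.distrib sum_distrib_left power2_eq_square)
      then show ?thesis using u fin Ny by (simp add: d_def if_distrib if_distribR cong: if_cong)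
    qed
    have "2 * (r - k * y u) = 0"
    proof (rule linear_coeff_zero_if_quadratic_nonpos[where b = "W u u - k"])
      fix t
      show "2 * (r - k * y u) * t + (W u u - k) * t\<^sup>2 \<le> 0"
        using le[of "\<lambda>w. y w + t * d w"] unfolding eq eqN by (simp add: algebra_simps)
    qed
    then show ?thesis by (simp add: r_def)
  qed
  ultimately show ?thesis by blast
qed

section \<open>Eigenvalues of the extended adjacency matrix\<close>

definition nbrs :: "'a pair_pre_digraph \<Rightarrow> 'a \<Rightarrow> 'a set" where
  "nbrs G u = {v. (u, v) \<in> parcs G}"

lemma vdeg_eq_card_nbrs: "vdeg G u = card (nbrs G u)"
proof -
  have "out_arcs (with_proj G) u = Pair u ` nbrs G u"
    by (auto simp: out_arcs_def nbrs_def)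
  then show ?thesis
    by (simp add: out_degree_def card_image inj_on_def)
qed

text \<open>The matrix entry indexed by vertices instead of positions, so that the arguments about
  graphs carry no numbering.\<close>

definition ext_weight :: "'a pair_pre_digraph \<Rightarrow> 'a \<Rightarrow> 'a \<Rightarrow> real" where
  "ext_weight G u v = (if (u, v) \<in> parcs G
     then (real (vdeg G u) / real (vdeg G v) + real (vdeg G v) / real (vdeg G u)) / 2 else 0)"

definition ext_eigenvalue :: "'a pair_pre_digraph \<Rightarrow> real \<Rightarrow> bool" where
  "ext_eigenvalue G k \<longleftrightarrow> (\<exists>x. (\<exists>u\<in>pverts G. x u \<noteq> 0) \<and>
     (\<forall>u\<in>pverts G. (\<Sum>v\<in>pverts G. ext_weight G u v * x v) = k * x u))"

text \<open>The numbering transports vectors to functions on the vertices and back. In particular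
  the spectrum does not depend on the numbering.\<close>

lemma spectrum_ext_adj_mat:
  assumes "vertex_numbering G v"
  shows "spectrum (ext_adj_mat G v) = {k. ext_eigenvalue G k}"
proof (intro Set.set_eqI iffI)
  let ?A = "ext_adj_mat G v" and ?n = "card (pverts G)"
  have bij: "bij_betw v {..<?n} (pverts G)"
    using assms by (simp add: vertex_numbering_def)
  have A: "?A $$ (i, j) = ext_weight G (v i) (v j)" if "i < ?n" "j < ?n" for i j
    using that by (simp add: ext_adj_mat_def ext_weight_def)
  have dim: "dim_row ?A = ?n" "dim_col ?A = ?n" by (auto simp: ext_adj_mat_def)
  have mult: "(?A *\<^sub>v y) $ i = (\<Sum>u\<in>pverts G. ext_weight G (v i) u * x u)"
    if i: "i < ?n" and y: "y \<in> carrier_vec ?n" and x: "\<And>j. j < ?n \<Longrightarrow> y $ j = x (v j)" for y x i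
  proof -
    have "(?A *\<^sub>v y) $ i = (\<Sum>j<?n. ext_weight G (v i) (v j) * x (v j))"
      using i y x A dim by (auto simp: scalar_prod_def atLeast0LessThan intro!: sum.cong)
    also have "\<dots> = (\<Sum>u\<in>pverts G. ext_weight G (v i) u * x u)"
      by (rule sum.reindex_bij_betw[OF bij, of "\<lambda>u. ext_weight G (v i) u * x u"])
    finally show ?thesis .
  qed
  {
    fix k assume "k \<in> spectrum ?A"
    then obtain y where y: "y \<in> carrier_vec ?n" "y \<noteq> 0\<^sub>v ?n" "?A *\<^sub>v y = k \<cdot>\<^sub>v y"
      using dim by (auto simp: spectrum_def eigenvalue_def eigenvector_def)
    define x where "x u = y $ (inv_into {..<?n} v u)" for u
    have x: "x (v j) = y $ j" if "j < ?n" for j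
      using bij that by (simp add: x_def bij_betw_def)
    have "(\<Sum>u\<in>pverts G. ext_weight G (v i) u * x u) = k * x (v i)" if "i < ?n" for i
      using mult[OF that y(1), of x] x y that by simp
    then have "\<forall>u\<in>v ` {..<?n}. (\<Sum>w\<in>pverts G. ext_weight G u w * x w) = k * x u"
      by blast
    then have "\<forall>u\<in>pverts G. (\<Sum>w\<in>pverts G. ext_weight G u w * x w) = k * x u"
      by (simp only: bij_betw_imp_surj_on[OF bij])
    moreover obtain j where "j < ?n" "y $ j \<noteq> 0"
      using y(1,2) by (metis carrier_vecD eq_vecI index_zero_vec)
    then have "\<exists>u\<in>pverts G. x u \<noteq> 0"
      using x bij by (force simp: bij_betw_def)
    ultimately show "k \<in> {k. ext_eigenvalue G k}"
      by (auto simp: ext_eigenvalue_def)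
  next
    fix k assume "k \<in> {k. ext_eigenvalue G k}"
    then obtain x u where x: "u \<in> pverts G" "x u \<noteq> 0"
      "\<forall>u\<in>pverts G. (\<Sum>v\<in>pverts G. ext_weight G u v * x v) = k * x u"
      by (auto simp: ext_eigenvalue_def)
    define y where "y = vec ?n (\<lambda>i. x (v i))"
    have y: "y \<in> carrier_vec ?n" "\<And>j. j < ?n \<Longrightarrow> y $ j = x (v j)" by (auto simp: y_def)
    have "?A *\<^sub>v y = k \<cdot>\<^sub>v y"
    proof (rule eq_vecI)
      fix i assume "i < dim_vec (k \<cdot>\<^sub>v y)"
      then have i: "i < ?n" by (simp add: y_def)
      then have "v i \<in> pverts G" using bij by (auto simp: bij_betw_def)
      then show "(?A *\<^sub>v y) $ i = (k \<cdot>\<^sub>v y) $ i"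
        using mult[OF i y(1) y(2)] x(3) i y by simp
    qed (use dim in \<open>simp add: y_def\<close>)
    moreover have "y \<noteq> 0\<^sub>v ?n"
    proof -
      have "u \<in> v ` {..<?n}" using x(1) by (simp only: bij_betw_imp_surj_on[OF bij])
      then obtain j where "j < ?n" "v j = u" by auto
      then show ?thesis using x(2) y(2) by (metis index_zero_vec(1))
    qed
    ultimately show "k \<in> spectrum ?A"
      using dim y(1) by (auto simp: spectrum_def eigenvalue_def eigenvector_def)
  }
qed

lemma ext_spectral_radius_eq_Max:
  assumes "vertex_numbering G v"
  shows "\<eta>\<^sub>1 G v = Max {k. ext_eigenvalue G k}"
  using spectrum_ext_adj_mat[OF assms] by (simp add: ext_spectral_radius_def)

text \<open>\<open>Max\<close> is meaningful only on a finite nonempty set; nonemptiness is settled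
  in the proof of \<open>ext_eigenvalue_spectral_radius\<close>.\<close>

lemma finite_ext_eigenvalues:
  assumes "vertex_numbering G v"
  shows "finite {k. ext_eigenvalue G k}"
  unfolding spectrum_ext_adj_mat[OF assms, symmetric]
  by (rule card_finite_spectrum(1)[where n = "card (pverts G)"]) (simp add: ext_adj_mat_def)

lemma ext_eigenvalue_le_spectral_radius:
  assumes "vertex_numbering G v" "ext_eigenvalue G k"
  shows "k \<le> \<eta>\<^sub>1 G v"
  using assms finite_ext_eigenvalues[OF assms(1)] by (simp add: ext_spectral_radius_eq_Max)

section \<open>Simple graphs, neighbourhoods and weights\<close>

lemma pair_graph_sym: "pair_graph G \<Longrightarrow> (u, v) \<in> parcs G \<Longrightarrow> (v, u) \<in> parcs G"
  using pair_sym_digraph.pair_sym_arcs[of G]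
  by (simp add: pair_graph_def pair_pseudo_graph_def symmetric_def symD)

lemma pair_graph_no_loop: "pair_graph G \<Longrightarrow> (u, u) \<notin> parcs G"
  using pair_loopfree_digraph.pair_no_loops[of G "(u, u)"]
  by (auto simp: pair_graph_def pair_digraph_def)

lemma pair_graph_finite: "pair_graph G \<Longrightarrow> finite (pverts G)"
  by (simp add: pair_fin_digraph.pair_finite_verts pair_graph_def pair_digraph_def)

lemma pair_graph_arc_verts:
  assumes "pair_graph G" "(u, v) \<in> parcs G"
  shows "u \<in> pverts G" "v \<in> pverts G"
  using assms pair_wf_digraph.in_arcsD1[of G] pair_wf_digraph.in_arcsD2[of G]
  by (auto simp: pair_graph_def pair_digraph_def pair_fin_digraph_def)

lemma pair_graph_arcs_subset: "pair_graph G \<Longrightarrow> parcs G \<subseteq> pverts G \<times> pverts G"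
  by (auto dest: pair_graph_arc_verts)

lemma nbrs_subset: "pair_graph G \<Longrightarrow> nbrs G u \<subseteq> pverts G"
  by (auto simp: nbrs_def dest: pair_graph_arc_verts)

lemma finite_nbrs: "pair_graph G \<Longrightarrow> finite (nbrs G u)"
  by (meson finite_subset nbrs_subset pair_graph_finite)

lemma nbrs_sym: "pair_graph G \<Longrightarrow> v \<in> nbrs G u \<Longrightarrow> u \<in> nbrs G v"
  by (simp add: nbrs_def pair_graph_sym)

lemma self_notin_nbrs: "pair_graph G \<Longrightarrow> u \<notin> nbrs G u"
  by (auto simp: nbrs_def pair_graph_no_loop)

lemma ext_weight_sym: "pair_graph G \<Longrightarrow> ext_weight G u v = ext_weight G v u"
  using pair_graph_sym[of G u v] pair_graph_sym[of G v u] by (auto simp: ext_weight_def add.commute)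

lemma ext_weight_nonneg: "ext_weight G u v \<ge> 0"
  by (simp add: ext_weight_def)

lemma vdeg_pos: "pair_graph G \<Longrightarrow> v \<in> nbrs G u \<Longrightarrow> vdeg G u > 0"
  by (auto simp: vdeg_eq_card_nbrs card_gt_0_iff finite_nbrs)

text \<open>This is \<open>t + 1 / t \<ge> 2\<close>, in the form
  \<open>(a - b)\<^sup>2 \<ge> 0\<close>. Hence the extended matrix dominates the ordinary adjacency
  matrix entrywise.\<close>

lemma ext_weight_ge_1:
  assumes "pair_graph G" "v \<in> nbrs G u"
  shows "ext_weight G u v \<ge> 1"
proof -
  define a b where "a = real (vdeg G u)" and "b = real (vdeg G v)"
  have "a > 0" "b > 0"
    using vdeg_pos[OF assms] vdeg_pos[OF assms(1) nbrs_sym[OF assms]] by (auto simp: a_def b_def)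
  moreover have "(a - b)\<^sup>2 \<ge> 0" by simp
  ultimately have "a / b + b / a \<ge> 2"
    by (simp add: field_simps power2_eq_square)
  then show ?thesis using assms by (simp add: ext_weight_def nbrs_def a_def b_def)
qed

lemma sum_ext_weight_eq_nbrs:
  assumes "pair_graph G"
  shows "(\<Sum>v\<in>pverts G. ext_weight G u v * x v) = (\<Sum>v\<in>nbrs G u. ext_weight G u v * x v)"
  using nbrs_subset[OF assms] pair_graph_finite[OF assms]
  by (intro sum.mono_neutral_right) (auto simp: ext_weight_def nbrs_def)

text \<open>Multiplying the inequality at \<open>u\<close> by \<open>x u\<close> and summing bounds
  the Rayleigh quotient of \<open>x\<close> from below. Vertices with \<open>x u = 0\<close>
  contribute nothing, so the inequality is asked for only on the support and \<open>x\<close> may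
  live on a small part of the graph.\<close>

lemma ext_eigenvalue_ge_if_subsolution:
  assumes G: "pair_graph G"
    and x: "\<And>u. x u \<ge> 0" "u0 \<in> pverts G" "x u0 > 0"
    and sub: "\<And>u. u \<in> pverts G \<Longrightarrow> x u > 0 \<Longrightarrow> c * x u \<le> (\<Sum>v\<in>nbrs G u. ext_weight G u v * x v)"
  shows "\<exists>k\<ge>c. ext_eigenvalue G k"
proof -
  have "c * (\<Sum>u\<in>pverts G. (x u)\<^sup>2) \<le>
      (\<Sum>u\<in>pverts G. x u * (\<Sum>v\<in>pverts G. ext_weight G u v * x v))"
    unfolding sum_distrib_left
  proof (rule sum_mono)
    fix u assume u: "u \<in> pverts G"
    show "c * (x u)\<^sup>2 \<le> (\<Sum>v\<in>pverts G. x u * (ext_weight G u v * x v))"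
    proof (cases "x u = 0")
      case False
      then have "x u > 0" using x(1)[of u] by simp
      from mult_left_mono[OF sub[OF u this] x(1)[of u]]
      show ?thesis
        unfolding sum_distrib_left[symmetric] sum_ext_weight_eq_nbrs[OF G]
        by (simp add: power2_eq_square mult_ac)
    qed simp
  qed
  then have "\<exists>k y. c \<le> k \<and> (\<exists>u\<in>pverts G. y u \<noteq> 0) \<and>
      (\<forall>u\<in>pverts G. (\<Sum>v\<in>pverts G. ext_weight G u v * y v) = k * y u)"
    using x(2,3)
    by (intro symmetric_eigenvalue_ge_Rayleigh_quotient[where a = u0 and x = x] pair_graph_finite
        ext_weight_sym G) simp_all
  then show ?thesis by (auto simp: ext_eigenvalue_def)
qed

text \<open>The constant function 1 is a subsolution for the value 0, since weights are nonnegative.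
  So a real eigenvalue exists and the maximum is attained.\<close>

lemma ext_eigenvalue_spectral_radius:
  assumes "pair_graph G" "pverts G \<noteq> {}" "vertex_numbering G v"
  shows "ext_eigenvalue G (\<eta>\<^sub>1 G v)"
proof -
  obtain u where "u \<in> pverts G" using assms(2) by auto
  then have "\<exists>k\<ge>0. ext_eigenvalue G k"
    by (intro ext_eigenvalue_ge_if_subsolution[OF assms(1), of "\<lambda>_. 1"])
      (auto intro: sum_nonneg ext_weight_nonneg)
  then have "{k. ext_eigenvalue G k} \<noteq> {}" by auto
  from Max_in[OF finite_ext_eigenvalues[OF assms(3)] this] show ?thesis
    by (simp add: ext_spectral_radius_eq_Max[OF assms(3)])
qed

section \<open>Invariance under isomorphism\<close>

text \<open>A \<open>digraph_iso\<close> carries separate maps for vertices and arcs. As arcs are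
  pairs of vertices, compatibility with heads and tails forces the arc map to be
  \<open>map_prod f f\<close>, which is injective because \<open>f\<close> is.\<close>

lemma graph_iso_bij:
  assumes G: "pair_graph G" and iso: "G \<cong>\<^sub>g H"
  obtains f where "bij_betw f (pverts G) (pverts H)"
    "\<And>u v. u \<in> pverts G \<Longrightarrow> v \<in> pverts G \<Longrightarrow> (f u, f v) \<in> parcs H \<longleftrightarrow> (u, v) \<in> parcs G"
proof -
  obtain hom where hom: "pre_digraph.digraph_isomorphism (with_proj G) hom"
    "with_proj H = app_iso hom (with_proj G)"
    using iso by (auto simp: digraph_iso_def)
  define f where "f = iso_verts hom"
  have H: "pverts H = f ` pverts G" "parcs H = iso_arcs hom ` parcs G"
    "iso_tail hom = fst" "iso_head hom = snd"
    using hom(2) by (simp_all add: app_iso_def with_proj_def f_def)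
  have inj: "inj_on f (pverts G)"
    and "\<forall>a\<in>parcs G. f (fst a) = fst (iso_arcs hom a) \<and> f (snd a) = snd (iso_arcs hom a)"
    using hom(1) by (simp_all add: pre_digraph.digraph_isomorphism_def f_def H(3,4))
  then have "parcs H = map_prod f f ` parcs G"
    unfolding H(2) by (intro image_cong) (auto simp: prod_eq_iff)
  then have "(f u, f v) \<in> parcs H \<longleftrightarrow> (u, v) \<in> parcs G" if "u \<in> pverts G" "v \<in> pverts G" for u v
    using that inj_on_image_mem_iff[OF map_prod_inj_on[OF inj inj] _ pair_graph_arcs_subset[OF G],
        of "(u, v)"]
    by simp
  moreover have "bij_betw f (pverts G) (pverts H)"
    unfolding H(1) by (rule inj_on_imp_bij_betw[OF inj])
  ultimately show ?thesis by (rule that[rotated])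
qed

text \<open>Converse of \<open>graph_iso_bij\<close>: the vertex bijection is completed by the arc
  map \<open>map_prod f f\<close>.\<close>

lemma graph_isoI:
  assumes G: "pair_graph G" and H: "pair_graph H"
    and f: "bij_betw f (pverts G) (pverts H)"
    "\<And>u v. u \<in> pverts G \<Longrightarrow> v \<in> pverts G \<Longrightarrow> (f u, f v) \<in> parcs H \<longleftrightarrow> (u, v) \<in> parcs G"
  shows "G \<cong>\<^sub>g H"
proof -
  define hom where "hom = \<lparr>iso_verts = f, iso_arcs = map_prod f f, iso_head = snd, iso_tail = fst\<rparr>"
  have inj: "inj_on f (pverts G)" using f(1) by (simp add: bij_betw_def)
  have "wf_digraph (with_proj G)"
    using pair_graph_arc_verts[OF G] by unfold_locales auto
  moreover have "inj_on (map_prod f f) (parcs G)"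
    by (rule inj_on_subset[OF map_prod_inj_on[OF inj inj] pair_graph_arcs_subset[OF G]])
  ultimately have "pre_digraph.digraph_isomorphism (with_proj G) hom"
    using inj by (simp add: pre_digraph.digraph_isomorphism_def hom_def)
  moreover have "parcs H = map_prod f f ` parcs G"
  proof (intro equalityI subrelI)
    fix a b assume ab: "(a, b) \<in> parcs H"
    have "a \<in> f ` pverts G" "b \<in> f ` pverts G"
      using pair_graph_arc_verts[OF H ab] by (simp_all only: bij_betw_imp_surj_on[OF f(1)])
    then obtain u v where "u \<in> pverts G" "v \<in> pverts G" "a = f u" "b = f v"
      by blast
    then show "(a, b) \<in> map_prod f f ` parcs G" using ab f(2) by force
  qed (use f(2) pair_graph_arc_verts[OF G] in auto)
  then have "with_proj H = app_iso hom (with_proj G)"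
    using f(1) by (simp add: app_iso_def hom_def with_proj_def bij_betw_def)
  ultimately show ?thesis by (auto simp: digraph_iso_def)
qed

text \<open>The bijection preserves neighbourhoods, hence degrees and weights; eigenfunctions are
  transported along it in both directions.\<close>

lemma ext_eigenvalue_iso:
  assumes G: "pair_graph G" and H: "pair_graph H" and iso: "G \<cong>\<^sub>g H"
  shows "ext_eigenvalue G k \<longleftrightarrow> ext_eigenvalue H k"
proof -
  obtain f where f: "bij_betw f (pverts G) (pverts H)"
    "\<And>u v. u \<in> pverts G \<Longrightarrow> v \<in> pverts G \<Longrightarrow> (f u, f v) \<in> parcs H \<longleftrightarrow> (u, v) \<in> parcs G"
    using graph_iso_bij[OF G iso] by blast
  then have inj: "inj_on f (pverts G)" and surj: "f ` pverts G = pverts H"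
    by (auto simp: bij_betw_def)
  have "nbrs H (f u) = f ` nbrs G u" if u: "u \<in> pverts G" for u
  proof
    show "nbrs H (f u) \<subseteq> f ` nbrs G u"
    proof
      fix w assume w: "w \<in> nbrs H (f u)"
      then have "w \<in> f ` pverts G" using nbrs_subset[OF H] unfolding surj by blast
      then obtain v where "v \<in> pverts G" "w = f v" by blast
      then show "w \<in> f ` nbrs G u" using w f(2)[OF u] by (auto simp: nbrs_def)
    qed
    show "f ` nbrs G u \<subseteq> nbrs H (f u)"
      using f(2)[OF u] pair_graph_arc_verts(2)[OF G] by (auto simp: nbrs_def)
  qed
  then have deg: "vdeg H (f u) = vdeg G u" if "u \<in> pverts G" for u
    using that inj_on_subset[OF inj nbrs_subset[OF G]] by (simp add: vdeg_eq_card_nbrs card_image)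
  have w: "ext_weight H (f u) (f v) = ext_weight G u v" if "u \<in> pverts G" "v \<in> pverts G" for u v
    using that f(2) deg by (simp add: ext_weight_def)
  have sum: "(\<Sum>v\<in>pverts H. ext_weight H (f u) v * x v) = (\<Sum>v\<in>pverts G. ext_weight G u v * x (f v))"
    if "u \<in> pverts G" for u and x :: "'b \<Rightarrow> real"
    using that w by (simp add: sum.reindex_bij_betw[OF f(1), symmetric])
  show ?thesis
  proof
    assume "ext_eigenvalue H k"
    then obtain x where "\<exists>u\<in>pverts H. x u \<noteq> 0"
      "\<forall>u\<in>pverts H. (\<Sum>v\<in>pverts H. ext_weight H u v * x v) = k * x u"
      by (auto simp: ext_eigenvalue_def)
    then have "\<exists>u\<in>f ` pverts G. x u \<noteq> 0"
      "\<forall>u\<in>f ` pverts G. (\<Sum>v\<in>pverts H. ext_weight H u v * x v) = k * x u"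
      by (simp_all only: surj)
    then have "(\<exists>u\<in>pverts G. x (f u) \<noteq> 0) \<and>
        (\<forall>u\<in>pverts G. (\<Sum>v\<in>pverts G. ext_weight G u v * x (f v)) = k * x (f u))"
      using sum by simp
    then show "ext_eigenvalue G k"
      unfolding ext_eigenvalue_def by (intro exI[of _ "\<lambda>u. x (f u)"])
  next
    assume "ext_eigenvalue G k"
    then obtain y where y: "\<exists>u\<in>pverts G. y u \<noteq> 0"
      "\<forall>u\<in>pverts G. (\<Sum>v\<in>pverts G. ext_weight G u v * y v) = k * y u"
      by (auto simp: ext_eigenvalue_def)
    define x where "x = y \<circ> inv_into (pverts G) f"
    have x: "x (f u) = y u" if "u \<in> pverts G" for u
      using that inj by (simp add: x_def)
    have "\<exists>u\<in>f ` pverts G. x u \<noteq> 0"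
      using y(1) x by simp
    moreover have "\<forall>u\<in>f ` pverts G. (\<Sum>v\<in>pverts H. ext_weight H u v * x v) = k * x u"
      using sum y(2) x by simp
    ultimately show "ext_eigenvalue H k"
      unfolding ext_eigenvalue_def by (intro exI[of _ x]) (simp only: surj)
  qed
qed

lemma ext_spectral_radius_iso:
  assumes "pair_graph G" "pair_graph H" "G \<cong>\<^sub>g H" "vertex_numbering G v" "vertex_numbering H w"
  shows "\<eta>\<^sub>1 G v = \<eta>\<^sub>1 H w"
  using ext_eigenvalue_iso[OF assms(1-3)] assms(4,5) by (simp add: ext_spectral_radius_eq_Max)

section \<open>Trees\<close>

lemma simple_tree_pair_graph: "simple_tree G \<Longrightarrow> pair_graph G"
  by (simp add: simple_tree_def)

section \<open>Cycles given by vertex lists\<close>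

lemma pcas_zip: "pcas u (zip (u # us) (us @ [w])) w"
  by (induction us arbitrary: u) auto

lemma pawalk_verts_zip: "pawalk_verts u (zip (u # us) (us @ [w])) = u # us @ [w]"
  by (induction us arbitrary: u) auto

lemma set_zip_subset_if_successively:
  "successively (\<lambda>a b. (a, b) \<in> E) (u # us @ [w]) \<Longrightarrow> set (zip (u # us) (us @ [w])) \<subseteq> E"
  by (induction us arbitrary: u) auto

text \<open>The arc list of a closed vertex list is the list zipped with its own shift. It has one
  arc more than \<open>us\<close> has vertices, hence at least three.\<close>

lemma simple_tree_no_cycle:
  assumes G: "simple_tree G"
    and adj: "successively (\<lambda>a b. (a, b) \<in> parcs G) (u # us @ [u])"
    and us: "distinct (u # us)" "length us \<ge> 2"
  shows False
proof -
  define p where "p = zip (u # us) (us @ [u])"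
  have "set p \<subseteq> parcs G"
    unfolding p_def by (rule set_zip_subset_if_successively[OF adj])
  moreover have "u \<in> pverts G"
    using adj us(2) simple_tree_pair_graph[OF G]
    by (cases us) (auto dest: pair_graph_arc_verts)
  ultimately have "pre_digraph.awalk (with_proj G) u p u"
    by (simp add: pre_digraph.awalk_def cas_with_proj_eq p_def pcas_zip)
  moreover have "distinct (tl (pre_digraph.awalk_verts (with_proj G) u p))"
    using us by (simp add: awalk_verts_with_proj_eq p_def pawalk_verts_zip)
  moreover have "length p \<ge> 3" using us by (simp add: p_def)
  ultimately have "pre_digraph.cycle (with_proj G) p \<and> length p \<ge> 3"
    by (auto simp: pre_digraph.cycle_def)
  then show False using G by (auto simp: simple_tree_def)
qed

lemma simple_tree_no_triangle:
  assumes "simple_tree G" "v \<in> nbrs G u" "w \<in> nbrs G u"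
  shows "w \<notin> nbrs G v"
proof
  assume "w \<in> nbrs G v"
  then show False
    using simple_tree_no_cycle[of G u "[v, w]"] assms simple_tree_pair_graph[of G]
      pair_graph_sym[of G u w] pair_graph_no_loop[of G]
    by (auto simp: nbrs_def)
qed

text \<open>Otherwise \<open>u, v, w, v'\<close> closes up to a 4-cycle. This makes the coding of
  walks in \<open>simple_tree_sum_vdeg_nbrs_le\<close> injective.\<close>

lemma simple_tree_no_four_cycle:
  assumes "simple_tree G" "v \<in> nbrs G u" "v' \<in> nbrs G u" "w \<in> nbrs G v" "w \<in> nbrs G v'" "w \<noteq> u"
  shows "v = v'"
proof (rule ccontr)
  assume "v \<noteq> v'"
  then show False
    using simple_tree_no_cycle[of G u "[v, w, v']"] assms simple_tree_pair_graph[of G]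
      pair_graph_sym[of G u v'] pair_graph_sym[of G v' w] pair_graph_no_loop[of G]
    by (auto simp: nbrs_def)
qed

text \<open>A walk from a vertex of \<open>S\<close> to a vertex outside must leave \<open>S\<close>
  along some arc.\<close>

lemma simple_tree_cut_arc:
  assumes G: "simple_tree G" and S: "S \<subseteq> pverts G" "S \<noteq> {}" "S \<noteq> pverts G"
  obtains a b where "a \<in> S" "b \<notin> S" "(a, b) \<in> parcs G"
proof -
  note pg = simple_tree_pair_graph[OF G]
  obtain s t where st: "s \<in> S" "t \<in> pverts G" "t \<notin> S" using S by auto
  \<comment> \<open>\<open>connected\<close> refers to the symmetric closure, which adds no arcs to
    a symmetric graph.\<close>
  have eq: "parcs (mk_symmetric (with_proj G)) = parcs G"
    using pair_graph_sym[OF pg] by (auto simp: mk_symmetric_def)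
  have "s \<rightarrow>\<^sup>*\<^bsub>with_proj (mk_symmetric (with_proj G))\<^esub> t"
    using G st S by (auto simp: simple_tree_def connected_def strongly_connected_def)
  then have "(s, t) \<in> rtrancl_on (pverts G) (parcs G)"
    by (simp add: reachable_def eq)
  then have "(s, t) \<in> (parcs G)\<^sup>*"
    by (rule rtrancl_on_rtranclI)
  then have "\<exists>a b. a \<in> S \<and> b \<notin> S \<and> (a, b) \<in> parcs G"
    using st(1,3) by (induction rule: rtrancl_induct) blast+
  then show ?thesis using that by blast
qed

lemma vertex_numbering_path_graph: "vertex_numbering (path_graph n) id"
  by (simp add: vertex_numbering_def path_graph_def)

lemma vertex_numbering_star_graph: "vertex_numbering (star_graph n) id"
  by (simp add: vertex_numbering_def star_graph_def)

lemma pair_graphI: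
  assumes "finite (pverts G)" "parcs G \<subseteq> pverts G \<times> pverts G"
    "\<And>u v. (u, v) \<in> parcs G \<Longrightarrow> (v, u) \<in> parcs G" "\<And>u. (u, u) \<notin> parcs G"
  shows "pair_graph G"
proof
  show "finite (parcs G)" using assms(1,2) by (meson finite_SigmaI finite_subset)
qed (use assms in \<open>auto simp: symmetric_def sym_def\<close>)

lemma pair_graph_path_graph: "pair_graph (path_graph n)"
  by (rule pair_graphI) (auto simp: path_graph_def)

lemma pair_graph_star_graph: "pair_graph (star_graph n)"
  by (rule pair_graphI) (auto simp: star_graph_def)

section \<open>Recognising the path and the star by degrees\<close>

text \<open>Take a longest path. If it misses a vertex, some arc leaves it at a vertex
  \<open>a\<close>: an end point \<open>a\<close> would allow a longer path, and an inner
  \<open>a\<close> would have three neighbours.\<close>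

lemma simple_tree_ex_spanning_path_if_deg_le_2:
  assumes G: "simple_tree G" and deg: "\<And>u. u \<in> pverts G \<Longrightarrow> vdeg G u \<le> 2"
  obtains p where "distinct p" "set p = pverts G" "successively (\<lambda>a b. (a, b) \<in> parcs G) p"
proof -
  note pg = simple_tree_pair_graph[OF G]
  define Q where "Q p \<longleftrightarrow> p \<noteq> [] \<and> distinct p \<and> set p \<subseteq> pverts G \<and>
    successively (\<lambda>a b. (a, b) \<in> parcs G) p" for p
  obtain r where "r \<in> pverts G"
    using G by (auto simp: simple_tree_def connected_def strongly_connected_def)
  then have "Q [r]" by (simp add: Q_def)
  moreover have "length p \<le> card (pverts G)" if "Q p" for p
    using that pair_graph_finite[OF pg] by (metis Q_def card_mono distinct_card)
  ultimately obtain p where p: "Q p" "\<And>q. Q q \<Longrightarrow> length q \<le> length p"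
    using ex_has_greatest_nat[of Q "[r]" length "Suc (card (pverts G))"] by (force simp: less_Suc_eq_le)
  have "set p = pverts G"
  proof (rule ccontr)
    assume "set p \<noteq> pverts G"
    then obtain a b where ab: "a \<in> set p" "b \<notin> set p" "(a, b) \<in> parcs G"
      using simple_tree_cut_arc[OF G, of "set p"] p(1) by (auto simp: Q_def)
    note ba = pair_graph_sym[OF pg ab(3)]
    obtain ys zs where yz: "p = ys @ a # zs" using ab(1) by (meson split_list)
    have b: "b \<in> pverts G" using pair_graph_arc_verts[OF pg ab(3)] by simp
    have "ys \<noteq> []"
    proof
      assume "ys = []"
      then have "Q (b # p)" using p(1) ba b ab(2) yz by (auto simp: Q_def)
      then show False using p(2)[of "b # p"] by simp
    qed
    moreover have "zs \<noteq> []"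
    proof
      assume "zs = []"
      then have "Q (p @ [b])" using p(1) ab b yz by (auto simp: Q_def successively_append_iff)
      then show False using p(2)[of "p @ [b]"] by simp
    qed
    ultimately obtain ys' y z zs' where yz': "p = ys' @ y # a # z # zs'"
      using yz by (metis append.assoc append_Cons append_Nil neq_Nil_conv rev_exhaust)
    then have "{y, z, b} \<subseteq> nbrs G a"
      using p(1) ab(3) pair_graph_sym[OF pg] by (auto simp: Q_def successively_append_iff nbrs_def)
    then have "card {y, z, b} \<le> vdeg G a"
      unfolding vdeg_eq_card_nbrs by (intro card_mono finite_nbrs pg)
    moreover have "card {y, z, b} = 3" using p(1) yz' ab(2) by (auto simp: Q_def)
    ultimately show False using deg[of a] p(1) ab(1) by (force simp: Q_def)
  qed
  then show ?thesis using that p(1) by (auto simp: Q_def)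
qed

text \<open>A spanning path has no chords in a tree, so it accounts for every edge, and the position
  in \<open>p\<close> is the isomorphism.\<close>

lemma simple_tree_iso_path_if_deg_le_2:
  assumes G: "simple_tree G" and deg: "\<And>u. u \<in> pverts G \<Longrightarrow> vdeg G u \<le> 2"
  shows "G \<cong>\<^sub>g path_graph (card (pverts G))"
proof -
  note pg = simple_tree_pair_graph[OF G]
  obtain p where p: "distinct p" "set p = pverts G" "successively (\<lambda>a b. (a, b) \<in> parcs G) p"
    using simple_tree_ex_spanning_path_if_deg_le_2[OF assms] by blast
  have len: "length p = card (pverts G)" using p by (metis distinct_card)
  have split: "p = take i p @ p ! i # take (j - i) (drop (Suc i) p) @ drop (Suc j) p"
    if "i < j" "j < length p" for i j
  proof -
    have "drop (Suc j) p = drop (j - i) (drop (Suc i) p)" using that by simp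
    then show ?thesis
      using that id_take_nth_drop[of i p] by (simp only: append_take_drop_id)
  qed
  have succ: "(p ! i, p ! Suc i) \<in> parcs G" if "Suc i < length p" for i
  proof -
    have "p = take i p @ p ! i # p ! Suc i # drop (Suc (Suc i)) p"
      using that by (metis Cons_nth_drop_Suc Suc_lessD append_take_drop_id)
    then show ?thesis using p(3) by (metis successively.simps(3) successively_append_iff)
  qed
  \<comment> \<open>The stretch of \<open>p\<close> from position \<open>i\<close> to position
    \<open>j\<close>, closed by the chord, would be a cycle. Here \<open>us\<close> runs over the
    positions \<open>Suc i\<close> to \<open>j\<close>, at least two by
    \<open>Suc i < j\<close>.\<close>
  have far: "(p ! i, p ! j) \<notin> parcs G" if "Suc i < j" "j < length p" for i j
  proof
    assume arc: "(p ! i, p ! j) \<in> parcs G"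
    define us where "us = take (j - i) (drop (Suc i) p)"
    have s: "p = take i p @ (p ! i # us) @ drop (Suc j) p"
      using split[of i j] that by (simp add: us_def)
    have "2 \<le> j - i" using that by simp
    moreover have "length us = j - i" using that by (simp add: us_def)
    moreover have "last us = p ! j"
      using that calculation by (subst last_conv_nth) (auto simp: us_def)
    moreover have "distinct (p ! i # us)" using p(1) s by (metis distinct_append)
    moreover have "successively (\<lambda>a b. (a, b) \<in> parcs G) (p ! i # us)"
      using p(3) s by (metis successively_append_iff)
    ultimately show False
      using simple_tree_no_cycle[OF G, of "p ! i" us] that pair_graph_sym[OF pg arc]
        successively_append_iff[of "\<lambda>a b. (a, b) \<in> parcs G" "p ! i # us" "[p ! i]"]
      by (auto split: if_splits)
  qed
  have arc_iff: "(p ! i, p ! j) \<in> parcs G \<longleftrightarrow> j = Suc i \<or> i = Suc j"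
    if "i < length p" "j < length p" for i j
  proof -
    consider "i = j" | "j = Suc i" | "i = Suc j" | "Suc i < j" | "Suc j < i" by linarith
    then show ?thesis
      using succ[of i] succ[of j] far[of i j] far[of j i] that pair_graph_no_loop[OF pg]
        pair_graph_sym[OF pg, of "p ! i" "p ! j"] pair_graph_sym[OF pg, of "p ! j" "p ! i"]
      by cases auto
  qed
  have bij: "bij_betw ((!) p) {..<length p} (pverts G)"
    using bij_betw_nth[OF p(1)] p(2) by simp
  define f where "f = inv_into {..<length p} ((!) p)"
  have f: "bij_betw f (pverts G) {..<length p}"
    unfolding f_def by (rule bij_betw_inv_into[OF bij])
  have fp: "p ! f u = u" if "u \<in> pverts G" for u
    using that bij by (simp add: f_def bij_betw_inv_into_right)
  show ?thesis
  proof (rule graph_isoI[OF pg pair_graph_path_graph])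
    show "bij_betw f (pverts G) (pverts (path_graph (card (pverts G))))"
      using f by (simp add: path_graph_def len)
    fix u v assume uv: "u \<in> pverts G" "v \<in> pverts G"
    then have "f u < length p" "f v < length p" using f by (auto simp: bij_betw_def)
    then show "((f u, f v) \<in> parcs (path_graph (card (pverts G)))) = ((u, v) \<in> parcs G)"
      using arc_iff[of "f u" "f v"] fp uv by (simp add: path_graph_def len)
  qed
qed

text \<open>The vertex \<open>c\<close> is adjacent to all others, so an edge avoiding
  \<open>c\<close> would complete a triangle. The isomorphism sends \<open>c\<close> to 0 and is
  arbitrary on the leaves.\<close>

lemma simple_tree_iso_star_if_full_deg:
  assumes G: "simple_tree G" and c: "c \<in> pverts G" "vdeg G c \<ge> card (pverts G) - 1"
  shows "G \<cong>\<^sub>g star_graph (card (pverts G))"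
proof -
  note pg = simple_tree_pair_graph[OF G]
  let ?n = "card (pverts G)"
  have fin: "finite (pverts G)" by (rule pair_graph_finite[OF pg])
  have "nbrs G c \<subseteq> pverts G - {c}"
    using nbrs_subset[OF pg] self_notin_nbrs[OF pg] by blast
  then have N: "nbrs G c = pverts G - {c}"
    using c fin by (intro card_seteq) (auto simp: vdeg_eq_card_nbrs)
  have arc_iff: "(u, v) \<in> parcs G \<longleftrightarrow> u \<noteq> v \<and> (u = c \<or> v = c)" if "u \<in> pverts G" "v \<in> pverts G" for u v
    using that simple_tree_no_triangle[OF G, of u c v] N pair_graph_no_loop[OF pg]
      pair_graph_sym[OF pg] unfolding nbrs_def by blast
  have "card (pverts G - {c}) = card {1..<?n}" using c fin by simp
  then obtain g where g: "bij_betw g (pverts G - {c}) {1..<?n}"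
    using fin finite_same_card_bij[of "pverts G - {c}" "{1..<?n}"] by auto
  have n: "?n > 0" using c fin by (auto simp: card_gt_0_iff)
  define f where "f u = (if u = c then 0 else g u)" for u
  have f0: "f u = 0 \<longleftrightarrow> u = c" if "u \<in> pverts G" for u
    using that bij_betwE[OF g] by (force simp: f_def)
  have f: "bij_betw f (pverts G) {..<?n}"
  proof -
    have "bij_betw f (pverts G - {c}) {1..<?n}"
      using g by (rule bij_betw_cong[THEN iffD1, rotated]) (auto simp: f_def)
    then have "bij_betw f (insert c (pverts G - {c})) (insert (f c) {1..<?n})"
      using notIn_Un_bij_betw[of c "pverts G - {c}" f "{1..<?n}"] by (simp add: f_def)
    moreover have "insert (f c) {1..<?n} = {..<?n}" using n by (auto simp: f_def)
    moreover have "insert c (pverts G - {c}) = pverts G" using c by auto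
    ultimately show ?thesis by simp
  qed
  show ?thesis
  proof (rule graph_isoI[OF pg pair_graph_star_graph])
    show "bij_betw f (pverts G) (pverts (star_graph ?n))"
      using f by (simp add: star_graph_def)
    fix u v assume uv: "u \<in> pverts G" "v \<in> pverts G"
    then have "f u < ?n" "f v < ?n" "f u = f v \<longleftrightarrow> u = v" using f by (auto simp: bij_betw_def inj_on_def)
    then show "((f u, f v) \<in> parcs (star_graph ?n)) = ((u, v) \<in> parcs G)"
      using arc_iff[OF uv] f0 uv by (simp add: star_graph_def)
  qed
qed

section \<open>Comparison with the star\<close>

text \<open>The sum counts the walks of length two from \<open>u\<close>. Without 4-cycles, walks
  not returning to \<open>u\<close> have distinct end points; without triangles, these end points
  are not neighbours of \<open>u\<close>, which leaves the neighbours free to code the returning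
  walks.\<close>

lemma simple_tree_sum_vdeg_nbrs_le:
  assumes G: "simple_tree G" and u: "u \<in> pverts G"
  shows "(\<Sum>v\<in>nbrs G u. vdeg G v) \<le> card (pverts G) - 1"
proof -
  note pg = simple_tree_pair_graph[OF G]
  define P where "P = Sigma (nbrs G u) (nbrs G)"
  \<comment> \<open>Code the walk \<open>u, v, w\<close> by its end point, and the returning walk \<open>u, v, u\<close> by \<open>v\<close>.\<close>
  define h where "h = (\<lambda>(v, w). if w = u then v else w)"
  have "inj_on h P"
  proof (rule inj_onI)
    fix a b assume ab: "a \<in> P" "b \<in> P" "h a = h b"
    obtain v w v' w' where [simp]: "a = (v, w)" "b = (v', w')" by (cases a; cases b)
    have n: "v \<in> nbrs G u" "w \<in> nbrs G v" "v' \<in> nbrs G u" "w' \<in> nbrs G v'"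
      using ab by (auto simp: P_def)
    show "a = b"
      using ab(3) simple_tree_no_triangle[OF G n(1,3)] simple_tree_no_triangle[OF G n(3,1)]
        simple_tree_no_four_cycle[OF G n(1,3,2)] n
      by (auto simp: h_def split: if_splits)
  qed
  moreover have "h ` P \<subseteq> pverts G - {u}"
    using subsetD[OF nbrs_subset[OF pg]] self_notin_nbrs[OF pg]
    by (auto simp: h_def P_def split: if_splits)
  ultimately have "card P \<le> card (pverts G - {u})"
    using pair_graph_finite[OF pg] by (intro card_inj_on_le) auto
  moreover have "card P = (\<Sum>v\<in>nbrs G u. vdeg G v)"
    unfolding P_def vdeg_eq_card_nbrs using finite_nbrs[OF pg] by (intro card_SigmaI) auto
  ultimately show ?thesis using u by simp
qed

text \<open>The ratio lies between \<open>1 / N\<close> and \<open>N\<close>, and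
  \<open>t + 1 / t\<close> is largest at these ends. Cleared of denominators, this is
  \<open>(N * a - b) * (N * b - a) \<ge> 0\<close>.\<close>

lemma ratio_plus_inverse_le:
  fixes a b N :: real
  assumes "1 \<le> a" "a \<le> N" "1 \<le> b" "b \<le> N"
  shows "a / b + b / a \<le> N + 1 / N"
proof -
  have "N * 1 \<le> N * a" "N * 1 \<le> N * b" using assms by (intro mult_left_mono; simp)+
  then have "b \<le> N * a" "a \<le> N * b" using assms by linarith+
  then have "(N * a - b) * (N * b - a) \<ge> 0" by (intro mult_nonneg_nonneg) auto
  then have "N * (a * a + b * b) \<le> (N * N + 1) * (a * b)" by (simp add: algebra_simps)
  moreover have "a / b + b / a = (a * a + b * b) / (a * b)" "N + 1 / N = (N * N + 1) / N"
    using assms by (simp_all add: field_simps)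
  ultimately show ?thesis using assms by (simp add: pos_divide_le_eq pos_le_divide_eq mult_ac)
qed

lemma ext_weight_le:
  assumes "pair_graph G" "v \<in> nbrs G u" "real (vdeg G u) \<le> N" "real (vdeg G v) \<le> N"
  shows "ext_weight G u v \<le> (N + 1 / N) / 2"
proof -
  have "1 \<le> vdeg G u" "1 \<le> vdeg G v"
    using vdeg_pos[OF assms(1,2)] vdeg_pos[OF assms(1) nbrs_sym[OF assms(1,2)]] by auto
  then have "1 \<le> real (vdeg G u)" "1 \<le> real (vdeg G v)" by simp_all
  from ratio_plus_inverse_le[OF this(1) assms(3) this(2) assms(4)] have
    "(real (vdeg G u) / real (vdeg G v) + real (vdeg G v) / real (vdeg G u)) / 2 \<le> (N + 1 / N) / 2"
    by (rule divide_right_mono) simp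
  then show ?thesis using assms(2) by (simp only: ext_weight_def nbrs_def mem_Collect_eq if_True)
qed

text \<open>At a vertex \<open>u\<close> where the eigenfunction is largest in absolute value, the
  eigenvalue equation is applied twice, and the degrees of the neighbours of \<open>u\<close> add up
  to at most \<open>card (pverts G) - 1\<close>.\<close>

lemma simple_tree_ext_eigenvalue_le:
  assumes G: "simple_tree G" and k: "ext_eigenvalue G k"
    and deg: "\<And>u. u \<in> pverts G \<Longrightarrow> real (vdeg G u) \<le> N" and N: "N > 0"
  shows "k \<le> (N + 1 / N) / 2 * sqrt (real (card (pverts G) - 1))"
proof -
  note pg = simple_tree_pair_graph[OF G]
  define h where "h = (N + 1 / N) / 2"
  have h: "h \<ge> 0" using N by (simp add: h_def)
  obtain x where x: "\<exists>u\<in>pverts G. x u \<noteq> 0"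
    "\<And>u. u \<in> pverts G \<Longrightarrow> (\<Sum>v\<in>nbrs G u. ext_weight G u v * x v) = k * x u"
    using k unfolding ext_eigenvalue_def sum_ext_weight_eq_nbrs[OF pg] by blast
  have fin: "finite (pverts G)" by (rule pair_graph_finite[OF pg])
  obtain u where u: "u \<in> pverts G" "\<And>v. v \<in> pverts G \<Longrightarrow> \<bar>x v\<bar> \<le> \<bar>x u\<bar>"
  proof -
    define m where "m = Max ((\<lambda>v. \<bar>x v\<bar>) ` pverts G)"
    have "m \<in> (\<lambda>v. \<bar>x v\<bar>) ` pverts G" unfolding m_def using fin x(1) by (intro Max_in) auto
    moreover have "\<bar>x v\<bar> \<le> m" if "v \<in> pverts G" for v unfolding m_def using fin that by (intro Max_ge) auto
    ultimately show ?thesis using that by auto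
  qed
  define M where "M = \<bar>x u\<bar>"
  have M: "M > 0" using x(1) u(2) unfolding M_def by force
  have w: "ext_weight G a b \<le> h" if "b \<in> nbrs G a" for a b
    unfolding h_def
    using that nbrs_subset[OF pg, of a] nbrs_subset[OF pg, of b] nbrs_sym[OF pg that]
    by (intro ext_weight_le[OF pg that] deg) auto
  \<comment> \<open>The degree of \<open>a\<close> is kept rather than bounded by \<open>N\<close>:
    at the second application these degrees are summed over the neighbours of
    \<open>u\<close>.\<close>
  have step: "\<bar>k * x a\<bar> \<le> h * real (vdeg G a) * M" if "a \<in> pverts G" for a
  proof -
    have "\<bar>k * x a\<bar> \<le> (\<Sum>b\<in>nbrs G a. \<bar>ext_weight G a b * x b\<bar>)"
      unfolding x(2)[OF that, symmetric] by (rule sum_abs)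
    also have "\<dots> \<le> (\<Sum>b\<in>nbrs G a. h * M)"
    proof (rule sum_mono)
      fix b assume b: "b \<in> nbrs G a"
      then have "\<bar>x b\<bar> \<le> M" using u(2) nbrs_subset[OF pg, of a] unfolding M_def by blast
      then show "\<bar>ext_weight G a b * x b\<bar> \<le> h * M"
        unfolding abs_mult using w[OF b] h ext_weight_nonneg[of G a b] by (intro mult_mono) auto
    qed
    also have "\<dots> = h * real (vdeg G a) * M" by (simp add: vdeg_eq_card_nbrs)
    finally show ?thesis .
  qed
  have "k\<^sup>2 * M = \<bar>\<Sum>v\<in>nbrs G u. ext_weight G u v * (k * x v)\<bar>"
  proof -
    have "(\<Sum>v\<in>nbrs G u. ext_weight G u v * (k * x v)) = k * (k * x u)"
      unfolding x(2)[OF u(1), symmetric] by (simp add: sum_distrib_left mult_ac)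
    then show ?thesis by (simp add: M_def abs_mult power2_eq_square)
  qed
  also have "\<dots> \<le> (\<Sum>v\<in>nbrs G u. \<bar>ext_weight G u v * (k * x v)\<bar>)" by (rule sum_abs)
  also have "\<dots> \<le> (\<Sum>v\<in>nbrs G u. h * (h * real (vdeg G v) * M))"
  proof (rule sum_mono)
    fix v assume v: "v \<in> nbrs G u"
    then have "v \<in> pverts G" using nbrs_subset[OF pg] by blast
    then show "\<bar>ext_weight G u v * (k * x v)\<bar> \<le> h * (h * real (vdeg G v) * M)"
      unfolding abs_mult[of "ext_weight G u v"] using w[OF v] step h ext_weight_nonneg[of G u v]
      by (intro mult_mono) auto
  qed
  also have "\<dots> = h\<^sup>2 * real (\<Sum>v\<in>nbrs G u. vdeg G v) * M"
    by (simp add: sum_distrib_left sum_distrib_right power2_eq_square mult_ac)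
  also have "\<dots> \<le> h\<^sup>2 * real (card (pverts G) - 1) * M"
    using simple_tree_sum_vdeg_nbrs_le[OF G u(1)] M
    by (intro mult_right_mono mult_left_mono of_nat_mono) auto
  finally have "k\<^sup>2 \<le> h\<^sup>2 * real (card (pverts G) - 1)" using M by simp
  then have "k \<le> sqrt (h\<^sup>2 * real (card (pverts G) - 1))" by (rule real_le_rsqrt)
  then show ?thesis using h by (simp add: real_sqrt_mult h_def)
qed

lemma nbrs_star_graph:
  "nbrs (star_graph n) i = (if i \<ge> n then {} else if i = 0 then {1..<n} else {0})"
  by (auto simp: nbrs_def star_graph_def)

text \<open>All edges have the same weight, so the principal eigenvector of the adjacency matrix
  serves: \<open>sqrt m\<close> at the centre and 1 at the leaves. The subsolution inequality holds
  with equality.\<close>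

lemma star_graph_ext_spectral_radius_ge:
  assumes n: "n \<ge> 2"
  shows "(real (n - 1) + 1 / real (n - 1)) / 2 * sqrt (real (n - 1)) \<le> \<eta>\<^sub>1 (star_graph n) id"
proof -
  let ?G = "star_graph n"
  define m where "m = real (n - 1)"
  have m: "m > 0" using n by (simp add: m_def)
  have deg: "real (vdeg ?G 0) = m" "\<And>i. 0 < i \<Longrightarrow> i < n \<Longrightarrow> real (vdeg ?G i) = 1"
    using n by (auto simp: vdeg_eq_card_nbrs nbrs_star_graph m_def)
  have w: "ext_weight ?G 0 i = (m + 1 / m) / 2" "ext_weight ?G i 0 = (m + 1 / m) / 2"
    if "0 < i" "i < n" for i
    using that by (auto simp: ext_weight_def deg add.commute) (auto simp: star_graph_def)
  define x where "x i = (if i = 0 then sqrt m else 1)" for i :: nat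
  have "\<exists>k\<ge>(m + 1 / m) / 2 * sqrt m. ext_eigenvalue ?G k"
  proof (rule ext_eigenvalue_ge_if_subsolution[OF pair_graph_star_graph])
    show "x i \<ge> 0" for i using m by (simp add: x_def)
    show "0 \<in> pverts ?G" using n by (simp add: star_graph_def)
    show "x 0 > 0" using m by (simp add: x_def)
    fix i assume "i \<in> pverts ?G"
    then have i: "i < n" by (simp add: star_graph_def)
    show "(m + 1 / m) / 2 * sqrt m * x i \<le> (\<Sum>j\<in>nbrs ?G i. ext_weight ?G i j * x j)"
    proof (cases "i = 0")
      case True
      have "(\<Sum>j\<in>nbrs ?G i. ext_weight ?G i j * x j) = real (card {1..<n}) * ((m + 1 / m) / 2)"
        unfolding sum_constant[symmetric]
        using True i w by (intro sum.cong) (auto simp: nbrs_star_graph x_def)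
      also have "\<dots> = m * ((m + 1 / m) / 2)" by (simp only: m_def card_atLeastLessThan)
      also have "\<dots> = (m + 1 / m) / 2 * sqrt m * x i"
        using m True by (simp add: x_def mult.assoc)
      finally show ?thesis by simp
    next
      case False
      then have "(\<Sum>j\<in>nbrs ?G i. ext_weight ?G i j * x j) = ext_weight ?G i 0 * sqrt m"
        using i by (simp add: nbrs_star_graph x_def)
      also have "\<dots> = (m + 1 / m) / 2 * sqrt m" using False i by (subst w(2)) auto
      finally show ?thesis using False by (simp add: x_def)
    qed
  qed
  then show ?thesis
    using ext_eigenvalue_le_spectral_radius[OF vertex_numbering_star_graph] unfolding m_def by force
qed

text \<open>Without a vertex of full degree, all degrees are at most \<open>N = n - 2\<close>.
  Strictness comes from replacing \<open>N\<close> by \<open>N + 1\<close> in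
  \<open>N + 1 / N\<close>, where \<open>1 / N \<le> 1 / 2\<close>.\<close>

lemma simple_tree_ext_spectral_radius_less_star:
  assumes G: "simple_tree G" and n: "card (pverts G) = n" "n \<ge> 4"
    and v: "vertex_numbering G v" and not_star: "\<not> G \<cong>\<^sub>g star_graph n"
  shows "\<eta>\<^sub>1 G v < \<eta>\<^sub>1 (star_graph n) id"
proof -
  note pg = simple_tree_pair_graph[OF G]
  define N where "N = real (n - 2)"
  have N: "N \<ge> 2" "real (n - 1) = N + 1" using n by (auto simp: N_def)
  have "real (vdeg G u) \<le> N" if "u \<in> pverts G" for u
    using simple_tree_iso_star_if_full_deg[OF G that] not_star n unfolding N_def by fastforce
  moreover have "pverts G \<noteq> {}" using n by auto
  ultimately have "\<eta>\<^sub>1 G v \<le> (N + 1 / N) / 2 * sqrt (real (card (pverts G) - 1))"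
    using simple_tree_ext_eigenvalue_le[OF G ext_eigenvalue_spectral_radius[OF pg _ v]] N by simp
  also have "\<dots> < ((N + 1) + 1 / (N + 1)) / 2 * sqrt (real (n - 1))"
  proof -
    have "1 / N \<le> 1 / 2" using N by (simp add: field_simps)
    moreover have "1 / (N + 1) > 0" using N by simp
    ultimately have "N + 1 / N < N + 1 + 1 / (N + 1)" by linarith
    then show ?thesis
      unfolding n(1) using n(2) by (intro mult_strict_right_mono) auto
  qed
  also have "\<dots> \<le> \<eta>\<^sub>1 (star_graph n) id"
    using star_graph_ext_spectral_radius_ge[of n] n(2) unfolding N(2) by simp
  finally show ?thesis .
qed

section \<open>Comparison with the path\<close>

text \<open>A Collatz-Wielandt bound: at a vertex maximising \<open>\<bar>x u\<bar> / q u\<close>,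
  the eigenvalue equation is dominated by the supersolution inequality scaled by that
  maximum.\<close>

lemma ext_eigenvalue_less_if_supersolution:
  assumes G: "pair_graph G" and k: "ext_eigenvalue G k"
    and q: "\<And>u. u \<in> pverts G \<Longrightarrow> q u > 0"
    and super: "\<And>u. u \<in> pverts G \<Longrightarrow> (\<Sum>v\<in>nbrs G u. ext_weight G u v * q v) < c * q u"
  shows "k < c"
proof -
  obtain x where x: "\<exists>u\<in>pverts G. x u \<noteq> 0"
    "\<And>u. u \<in> pverts G \<Longrightarrow> (\<Sum>v\<in>nbrs G u. ext_weight G u v * x v) = k * x u"
    using k unfolding ext_eigenvalue_def sum_ext_weight_eq_nbrs[OF G] by blast
  have fin: "finite (pverts G)" by (rule pair_graph_finite[OF G])
  define r where "r = Max ((\<lambda>v. \<bar>x v\<bar> / q v) ` pverts G)"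
  have "r \<in> (\<lambda>v. \<bar>x v\<bar> / q v) ` pverts G"
    unfolding r_def using fin x(1) by (intro Max_in) auto
  then obtain u where u: "u \<in> pverts G" "r = \<bar>x u\<bar> / q u" by blast
  have le: "\<bar>x v\<bar> \<le> r * q v" if "v \<in> pverts G" for v
  proof -
    have "\<bar>x v\<bar> / q v \<le> r" unfolding r_def using fin that by (intro Max_ge) auto
    then show ?thesis using q[OF that] by (simp add: field_simps)
  qed
  have xu: "\<bar>x u\<bar> = r * q u" using u q[OF u(1)] by simp
  have r: "r > 0"
  proof -
    obtain v where v: "v \<in> pverts G" "x v \<noteq> 0" using x(1) by blast
    then have "0 < r * q v" using le[OF v(1)] by linarith
    then show ?thesis using q[OF v(1)] by (simp add: zero_less_mult_iff)
  qed
  have "\<bar>k\<bar> * (r * q u) = \<bar>\<Sum>v\<in>nbrs G u. ext_weight G u v * x v\<bar>"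
    unfolding x(2)[OF u(1)] abs_mult xu ..
  also have "\<dots> \<le> (\<Sum>v\<in>nbrs G u. \<bar>ext_weight G u v * x v\<bar>)" by (rule sum_abs)
  also have "\<dots> \<le> (\<Sum>v\<in>nbrs G u. ext_weight G u v * (r * q v))"
  proof (rule sum_mono)
    fix v assume "v \<in> nbrs G u"
    then have "v \<in> pverts G" using nbrs_subset[OF G] by blast
    then show "\<bar>ext_weight G u v * x v\<bar> \<le> ext_weight G u v * (r * q v)"
      using le ext_weight_nonneg[of G u v] by (simp add: abs_mult mult_left_mono)
  qed
  also have "\<dots> = r * (\<Sum>v\<in>nbrs G u. ext_weight G u v * q v)"
    by (simp add: sum_distrib_left mult_ac)
  also have "\<dots> < r * (c * q u)" using super[OF u(1)] r by simp
  finally have "\<bar>k\<bar> * (r * q u) < c * (r * q u)" by (simp add: mult_ac)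
  then have "\<bar>k\<bar> < c" using r q[OF u(1)] by (simp add: mult_less_cancel_right)
  then show ?thesis by simp
qed

lemma nbrs_path_graph:
  "nbrs (path_graph n) i = (if i \<ge> n then {} else {j. j < n \<and> (j = Suc i \<or> i = Suc j)})"
  by (auto simp: nbrs_def path_graph_def)

text \<open>Only the two end edges join vertices of different degrees and weigh 5/4; all other edges
  weigh 1. An explicit positive supersolution for the value 2 copes with both.\<close>

lemma path_graph_ext_eigenvalue_less_2:
  assumes n: "n \<ge> 5" and k: "ext_eigenvalue (path_graph n) k"
  shows "k < 2"
proof -
  let ?G = "path_graph n"
  obtain m where m: "n = m + 5" using n by (metis add.commute le_Suc_ex)
  have nb: "nbrs ?G 0 = {Suc 0}" "nbrs ?G (m + 4) = {m + 3}"
    "\<And>i. i < m + 3 \<Longrightarrow> nbrs ?G (Suc i) = {i, Suc (Suc i)}"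
    unfolding nbrs_path_graph m by auto
  have deg: "vdeg ?G 0 = 1" "vdeg ?G (m + 4) = 1" "\<And>i. i < m + 3 \<Longrightarrow> vdeg ?G (Suc i) = 2"
    unfolding vdeg_eq_card_nbrs using nb by auto
  have arc: "(i, Suc i) \<in> parcs ?G" "(Suc i, i) \<in> parcs ?G" if "i < m + 4" for i
    using that by (auto simp: path_graph_def m)
  have w_end: "ext_weight ?G 0 (Suc 0) = 5/4" "ext_weight ?G (m + 4) (m + 3) = 5/4"
    "ext_weight ?G (Suc 0) 0 = 5/4" "ext_weight ?G (m + 3) (m + 4) = 5/4"
    using arc[of 0] arc[of "m + 3"] deg(1,2) deg(3)[of 0] deg(3)[of "m + 2"]
    by (auto simp: ext_weight_def eval_nat_numeral)
  have w_mid: "ext_weight ?G (Suc i) (Suc (Suc i)) = 1" "ext_weight ?G (Suc (Suc i)) (Suc i) = 1"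
    if "i < m + 2" for i
    using arc[of "Suc i"] deg(3)[of i] deg(3)[of "Suc i"] that by (auto simp: ext_weight_def)
  \<comment> \<open>A strictly concave profile, with constant term large enough that \<open>q 2 < 9/8 * q 1\<close>; the end
    value \<open>7/10 * q 1\<close> leaves slack at both ends of the end edges, whose weight is 5/4.\<close>
  define q :: "nat \<Rightarrow> real" where "q i = (if i = 0 \<or> i = m + 4 then 7/10 * (9 * real m + 43)
    else 8 * (real m + 5) + real i * (real m + 4 - real i))" for i
  show ?thesis
  proof (rule ext_eigenvalue_less_if_supersolution[OF pair_graph_path_graph k, of q])
    fix i assume "i \<in> pverts ?G"
    then have i: "i < m + 5" by (simp add: path_graph_def m)
    show "q i > 0"
    proof (cases "i = 0 \<or> i = m + 4")
      case False
      have "0 \<le> real i * (real m + 4 - real i)" using i by (intro mult_nonneg_nonneg) auto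
      then show ?thesis using False by (simp add: q_def add_pos_nonneg)
    qed (auto simp: q_def)
    consider "i = 0" | "i = m + 4" | "i = 1" | "i = m + 3" | j where "i = Suc (Suc j)" "j < m + 1"
    proof -
      assume a: "i = 0 \<Longrightarrow> thesis" "i = m + 4 \<Longrightarrow> thesis" "i = 1 \<Longrightarrow> thesis" "i = m + 3 \<Longrightarrow> thesis"
        "\<And>j. i = Suc (Suc j) \<Longrightarrow> j < m + 1 \<Longrightarrow> thesis"
      have "i = 0 \<or> i = m + 4 \<or> i = 1 \<or> i = m + 3 \<or> i = Suc (Suc (i - 2)) \<and> i - 2 < m + 1"
        using i by linarith
      then show thesis using a by blast
    qed
    then show "(\<Sum>j\<in>nbrs ?G i. ext_weight ?G i j * q j) < 2 * q i"
    proof cases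
      case 1
      then show ?thesis by (simp add: nb(1) w_end(1) q_def)
    next
      case 2
      have "q (m + 3) = 9 * real m + 43" "q (m + 4) = 7/10 * (9 * real m + 43)" by (simp_all add: q_def)
      then show ?thesis unfolding 2 nb(2) by (simp add: w_end(2))
    next
      case 3
      have "q 0 = 7/10 * (9 * real m + 43)" "q (Suc 0) = 9 * real m + 43" "q 2 = 10 * real m + 44"
        by (simp_all add: q_def)
      moreover have "nbrs ?G (Suc 0) = {0, 2}" using nb(3)[of 0] by (simp add: numeral_2_eq_2)
      moreover have "ext_weight ?G (Suc 0) 2 = 1" using w_mid(1)[of 0] by (simp add: numeral_2_eq_2)
      ultimately show ?thesis unfolding 3 by (simp add: w_end(3))
    next
      case 4
      have "q (m + 4) = 7/10 * (9 * real m + 43)" "q (m + 3) = 9 * real m + 43" "q (m + 2) = 10 * real m + 44"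
        by (simp_all add: q_def algebra_simps)
      moreover have "nbrs ?G (m + 3) = {m + 2, m + 4}" using nb(3)[of "m + 2"] by (simp add: eval_nat_numeral)
      moreover have "ext_weight ?G (m + 3) (m + 2) = 1" using w_mid(2)[of "m + 1"] by (simp add: eval_nat_numeral)
      ultimately show ?thesis unfolding 4 by (simp add: w_end(4))
    next
      case 5
      have w: "ext_weight ?G i (Suc j) = 1" "ext_weight ?G i (Suc (Suc (Suc j))) = 1"
        using w_mid(2)[of j] w_mid(1)[of "Suc j"] 5 by auto
      have "nbrs ?G i = {Suc j, Suc (Suc (Suc j))}" using nb(3)[of "Suc j"] 5 by simp
      then have "(\<Sum>j\<in>nbrs ?G i. ext_weight ?G i j * q j) = q (Suc j) + q (Suc (Suc (Suc j)))"
        using w by simp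
      \<comment> \<open>All three indices lie between 1 and \<open>m + 3\<close>, where
        \<open>q\<close> is a quadratic with second difference -2.\<close>
      also have "\<dots> < 2 * q i"
        using 5 by (simp add: q_def algebra_simps)
      finally show ?thesis .
    qed
  qed
qed

section \<open>Trees with a vertex of degree at least 3\<close>

text \<open>Weights are at least 1 and all terms are nonnegative, so subsolutions can be tested with
  unweighted sums over the neighbours at hand.\<close>

lemma sum_le_sum_ext_weight_nbrs:
  assumes G: "pair_graph G" and x: "\<And>v. x v \<ge> 0" and F: "F \<subseteq> nbrs G u"
  shows "(\<Sum>v\<in>F. x v) \<le> (\<Sum>v\<in>nbrs G u. ext_weight G u v * x v)"
proof -
  have "(\<Sum>v\<in>F. x v) \<le> (\<Sum>v\<in>F. ext_weight G u v * x v)"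
  proof (rule sum_mono)
    fix v assume "v \<in> F"
    then show "x v \<le> ext_weight G u v * x v"
      using mult_right_mono[OF ext_weight_ge_1[OF G, of v u] x[of v]] F by auto
  qed
  also have "\<dots> \<le> (\<Sum>v\<in>nbrs G u. ext_weight G u v * x v)"
    using F x finite_nbrs[OF G] by (intro sum_mono2) (auto intro!: mult_nonneg_nonneg ext_weight_nonneg)
  finally show ?thesis .
qed

text \<open>If \<open>c\<close> has four neighbours, or three that all extend further, the tree is
  compared with an affine Dynkin diagram, whose adjacency matrix has largest eigenvalue 2. In the
  remaining case \<open>c\<close> has degree 3 and a leaf, and the larger weight of the leaf edge
  makes up for the missing vertices.\<close>

lemma simple_tree_ext_eigenvalue_ge_2:
  assumes G: "simple_tree G" and c: "c \<in> pverts G" "vdeg G c \<ge> 3"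
  shows "\<exists>k\<ge>2. ext_eigenvalue G k"
proof -
  note pg = simple_tree_pair_graph[OF G]
  let ?N = "nbrs G c"
  have c_nbr: "{c} \<subseteq> nbrs G v" if "v \<in> ?N" for v using nbrs_sym[OF pg that] by simp
  have fin: "finite ?N" by (rule finite_nbrs[OF pg])
  have cN: "c \<notin> ?N" by (rule self_notin_nbrs[OF pg])
  have "vdeg G c \<ge> 4 \<or> vdeg G c = 3" using c(2) by linarith
  then consider "vdeg G c \<ge> 4" | l where "vdeg G c = 3" "l \<in> ?N" "vdeg G l = 1"
    | "vdeg G c = 3" "\<And>v. v \<in> ?N \<Longrightarrow> vdeg G v \<noteq> 1"
    by blast
  then show ?thesis
  proof cases
    case 1
    then obtain F where F: "F \<subseteq> ?N" "card F = 4"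
      using obtain_subset_with_card_n[of 4 ?N] by (auto simp: vdeg_eq_card_nbrs)
    \<comment> \<open>The eigenvector for 2 of the star with four leaves, the affine diagram of type
      D4.\<close>
    define x :: "'a \<Rightarrow> real" where "x v = (if v = c then 2 else if v \<in> F then 1 else 0)" for v
    have x0: "x v \<ge> 0" for v by (simp add: x_def)
    show ?thesis
    proof (rule ext_eigenvalue_ge_if_subsolution[where x = x, OF pg x0 c(1)])
      show "x c > 0" by (simp add: x_def)
      fix u assume "x u > 0"
      then consider "u = c" | "u \<in> F" "u \<noteq> c" by (auto simp: x_def split: if_splits)
      then show "2 * x u \<le> (\<Sum>v\<in>nbrs G u. ext_weight G u v * x v)"
      proof cases
        case 1
        have "(\<Sum>v\<in>F. x v) = (\<Sum>v\<in>F. 1)" using F(1) cN by (intro sum.cong) (auto simp: x_def)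
        then have "(\<Sum>v\<in>F. x v) = 4" using F(2) by simp
        then show ?thesis
          using sum_le_sum_ext_weight_nbrs[where x = x, OF pg x0 F(1)] 1 by (simp add: x_def)
      next
        case 2
        then have "u \<in> ?N" using F(1) by blast
        then show ?thesis
          using sum_le_sum_ext_weight_nbrs[where x = x, OF pg x0 c_nbr] 2 by (simp add: x_def)
      qed
    qed
  next
    case (2 l)
    \<comment> \<open>The edge from \<open>c\<close> to \<open>l\<close> weighs
      \<open>(3 + 1/3) / 2 = 5/3\<close>. The value 5/3 gives equality at \<open>l\<close>, and at
      \<open>c\<close> the sum is at least \<open>25/9 + 2\<close>, which exceeds 4.\<close>
    define x :: "'a \<Rightarrow> real" where
      "x v = (if v = c then 2 else if v = l then 5/3 else if v \<in> ?N then 1 else 0)" for v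
    have x0: "x v \<ge> 0" for v by (simp add: x_def)
    have lc: "l \<noteq> c" using 2 cN by blast
    have w: "ext_weight G c l = 5/3" "ext_weight G l c = 5/3"
      using 2 nbrs_sym[OF pg 2(2)] by (auto simp: ext_weight_def nbrs_def)
    show ?thesis
    proof (rule ext_eigenvalue_ge_if_subsolution[where x = x, OF pg x0 c(1)])
      show "x c > 0" by (simp add: x_def)
      fix u assume "x u > 0"
      then consider "u = c" | "u = l" | "u \<in> ?N" "u \<noteq> l" "u \<noteq> c" by (auto simp: x_def split: if_splits)
      then show "2 * x u \<le> (\<Sum>v\<in>nbrs G u. ext_weight G u v * x v)"
      proof cases
        case 1
        have "(\<Sum>v\<in>?N - {l}. ext_weight G c v * x v) \<ge> (\<Sum>v\<in>?N - {l}. 1)"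
          using ext_weight_ge_1[OF pg] cN by (intro sum_mono) (auto simp: x_def)
        moreover have "card (?N - {l}) = 2" using 2 fin by (simp add: vdeg_eq_card_nbrs)
        moreover have "(\<Sum>v\<in>?N. ext_weight G c v * x v) =
            ext_weight G c l * x l + (\<Sum>v\<in>?N - {l}. ext_weight G c v * x v)"
          using 2(2) fin by (rule sum.remove[rotated])
        ultimately show ?thesis using 1 w lc by (simp add: x_def)
      next
        case l: 2
        obtain a where a: "nbrs G l = {a}"
          using 2(3) unfolding vdeg_eq_card_nbrs by (rule card_1_singletonE)
        have "c = a" using c_nbr[OF 2(2)] unfolding a by simp
        then have "nbrs G l = {c}" using a by simp
        then show ?thesis using lc by (simp add: l w x_def)
      next
        case 3
        then show ?thesis
          using sum_le_sum_ext_weight_nbrs[where x = x, OF pg x0 c_nbr] by (simp add: x_def)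
      qed
    qed
  next
    case 3
    have "\<exists>w. w \<in> nbrs G v \<and> w \<noteq> c" if "v \<in> ?N" for v
    proof (rule ccontr)
      assume "\<not> ?thesis"
      then have "nbrs G v = {c}" using c_nbr[OF that] by blast
      then show False using 3(2)[OF that] by (simp add: vdeg_eq_card_nbrs)
    qed
    then obtain g where g: "\<And>v. v \<in> ?N \<Longrightarrow> g v \<in> nbrs G v \<and> g v \<noteq> c" by metis
    \<comment> \<open>Without triangles the second vertex of a branch is not a neighbour of
      \<open>c\<close>, so its value below is 1 and not 2.\<close>
    have gN: "g v \<notin> ?N" if "v \<in> ?N" for v
      using g[OF that] simple_tree_no_triangle[OF G that] by blast
    \<comment> \<open>The eigenvector for 2 of the affine diagram of type E6: values 3, 2, 1 along
      each of three branches from \<open>c\<close>.\<close>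
    define x :: "'a \<Rightarrow> real" where
      "x v = (if v = c then 3 else if v \<in> ?N then 2 else if v \<in> g ` ?N then 1 else 0)" for v
    have x0: "x v \<ge> 0" for v by (simp add: x_def)
    show ?thesis
    proof (rule ext_eigenvalue_ge_if_subsolution[where x = x, OF pg x0 c(1)])
      show "x c > 0" by (simp add: x_def)
      fix u assume "x u > 0"
      then consider "u = c" | "u \<in> ?N" | v where "v \<in> ?N" "u = g v" by (auto simp: x_def split: if_splits)
      then show "2 * x u \<le> (\<Sum>v\<in>nbrs G u. ext_weight G u v * x v)"
      proof cases
        case 1
        have "(\<Sum>v\<in>?N. x v) = (\<Sum>v\<in>?N. 2)" using cN by (intro sum.cong) (auto simp: x_def)
        then have "(\<Sum>v\<in>?N. x v) = 6" using 3(1) by (simp add: vdeg_eq_card_nbrs)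
        then show ?thesis
          using sum_le_sum_ext_weight_nbrs[where x = x, OF pg x0, of ?N c] 1 by (simp add: x_def)
      next
        case 2
        have "{c, g u} \<subseteq> nbrs G u" using c_nbr[OF 2] g[OF 2] by simp
        from sum_le_sum_ext_weight_nbrs[where x = x, OF pg x0 this] show ?thesis
          using 2 cN g[OF 2] gN[OF 2] by (auto simp: x_def)
      next
        case v: (3 v)
        have "{v} \<subseteq> nbrs G u" using g[OF v(1)] nbrs_sym[OF pg] v(2) by simp
        moreover have "x v = 2" using v(1) cN by (auto simp: x_def)
        moreover have "x u = 1" using v g[OF v(1)] gN[OF v(1)] by (auto simp: x_def)
        ultimately show ?thesis
          using sum_le_sum_ext_weight_nbrs[where x = x, OF pg x0, of "{v}" u] by simp
      qed
    qed
  qed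
qed

lemma path_ext_spectral_radius_less_simple_tree:
  assumes G: "simple_tree G" and n: "card (pverts G) = n" "n \<ge> 5"
    and v: "vertex_numbering G v" and not_path: "\<not> G \<cong>\<^sub>g path_graph n"
  shows "\<eta>\<^sub>1 (path_graph n) id < \<eta>\<^sub>1 G v"
proof -
  have "0 \<in> pverts (path_graph n)" using n by (simp add: path_graph_def)
  then have "\<eta>\<^sub>1 (path_graph n) id < 2"
    using path_graph_ext_eigenvalue_less_2[OF n(2)]
      ext_eigenvalue_spectral_radius[OF pair_graph_path_graph _ vertex_numbering_path_graph, of n] by blast
  moreover obtain c where "c \<in> pverts G" "vdeg G c \<ge> 3"
    using simple_tree_iso_path_if_deg_le_2[OF G] not_path n by fastforce
  then obtain k where "k \<ge> 2" "ext_eigenvalue G k"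
    using simple_tree_ext_eigenvalue_ge_2[OF G] by blast
  ultimately show ?thesis using ext_eigenvalue_le_spectral_radius[OF v, of k] by linarith
qed

theorem theorem1p2:
  fixes n :: nat and T :: "'a pair_pre_digraph" and v :: "nat \<Rightarrow> 'a"
  assumes "n \<ge> 5"
    and "simple_tree T"
    and "card (pverts T) = n"
    and "vertex_numbering T v"
  shows "\<eta>\<^sub>1 (path_graph n) id \<le> \<eta>\<^sub>1 T v \<and> \<eta>\<^sub>1 T v \<le> \<eta>\<^sub>1 (star_graph n) id \<and>
    (\<eta>\<^sub>1 (path_graph n) id = \<eta>\<^sub>1 T v \<longleftrightarrow> T \<cong>\<^sub>g path_graph n) \<and>
    (\<eta>\<^sub>1 T v = \<eta>\<^sub>1 (star_graph n) id \<longleftrightarrow> T \<cong>\<^sub>g star_graph n)"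
proof -
  note pg = simple_tree_pair_graph[OF assms(2)]
  \<comment> \<open>For either bound, equality under isomorphism and strict inequality otherwise
    give both the inequality and its equality case.\<close>
  have "T \<cong>\<^sub>g path_graph n \<Longrightarrow> \<eta>\<^sub>1 T v = \<eta>\<^sub>1 (path_graph n) id"
    by (rule ext_spectral_radius_iso[OF pg pair_graph_path_graph _ assms(4) vertex_numbering_path_graph])
  moreover have "\<not> T \<cong>\<^sub>g path_graph n \<Longrightarrow> \<eta>\<^sub>1 (path_graph n) id < \<eta>\<^sub>1 T v"
    using path_ext_spectral_radius_less_simple_tree[OF assms(2,3,1,4)] .
  moreover have "T \<cong>\<^sub>g star_graph n \<Longrightarrow> \<eta>\<^sub>1 T v = \<eta>\<^sub>1 (star_graph n) id"
    by (rule ext_spectral_radius_iso[OF pg pair_graph_star_graph _ assms(4) vertex_numbering_star_graph])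
  moreover have "\<not> T \<cong>\<^sub>g star_graph n \<Longrightarrow> \<eta>\<^sub>1 T v < \<eta>\<^sub>1 (star_graph n) id"
    using simple_tree_ext_spectral_radius_less_star[OF assms(2,3) _ assms(4)] assms(1) by simp
  ultimately show ?thesis by (metis less_imp_le less_irrefl order_refl)
qed

end
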